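(* Let $k$ be a positive integer that is a perfect square. Then there is an integer $N=N(k)$ such that for each integer $n\ge N$ there exists a symmetric weighing matrix $W(n,k)$.
   Context: A weighing matrix $W(n,k)$ of order $n$ and weight $k$ is a square matrix $W$ of order $n$ with entries in $\{0,\pm1\}$ such that $WW^{\rm T}=kI_n$. It is symmetric if $W^{\rm T}=W$. *)

theory Defs
  imports
    "Jordan_Normal_Form.Matrix"
    "HOL-Computational_Algebra.Nth_Powers"
begin

definition weighing_matrix :: "nat \<Rightarrow> nat \<Rightarrow> int mat \<Rightarrow> bool" where
  "weighing_matrix n k W \<longleftrightarrow>
     W \<in> carrier_mat n n \<and> elements_mat W \<subseteq> {0, 1, -1} \<and>
     W * transpose_mat W = int k \<cdot>\<^sub>m 1\<^sub>m n"

definition symmetric_mat :: "'a mat \<Rightarrow> bool" where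
  "symmetric_mat W \<longleftrightarrow> transpose_mat W = W"

end

theory Submission
  imports Defs "HOL-Number_Theory.Euler_Criterion" "HOL-Library.FuncSet"
begin

text \<open>
  Direct sums show that the orders of symmetric weighing matrices of a fixed weight are closed
  under addition, so two coprime orders yield all sufficiently large ones; tensor products then
  reduce the claim to the weights $p^2$ with $p$ prime. For odd $p$, index rows and columns by the
  points of the projective space over $\mathbf{F}_p$ arising from $\mathbf{F}_p^n$, and let the
  entry at $(u, v)$ be the Legendre symbol of the inner product $u \cdot v$ of fixed
  representatives. This is a symmetric weighing matrix of order $(p^n - 1)/(p - 1)$ and weight
  $p^{n-1}$. The case $n = 3$ gives order $p^2 + p + 1$ and weight $p^2$, the tensor square of the
  case $n = 2$ gives order $(p + 1)^2$ and weight $p^2$, and these orders are coprime. For $p = 2$,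
  the orders 4 and 7 are realised by a Hadamard matrix and a back-circulant matrix.
\<close>

section \<open>Direct sums and tensor products\<close>

text \<open>
  Arbitrary index sets are allowed because direct sums, tensor products and projective spaces
  come with natural index sets other than an initial segment of the naturals.
\<close>
definition sym_weighing_on :: "'a set \<Rightarrow> nat \<Rightarrow> ('a \<Rightarrow> 'a \<Rightarrow> int) \<Rightarrow> bool" where
  "sym_weighing_on X k f \<longleftrightarrow>
     (\<forall>x\<in>X. \<forall>y\<in>X. f x y \<in> {0, 1, -1} \<and> f x y = f y x \<and>
        (\<Sum>z\<in>X. f x z * f y z) = (if x = y then int k else 0))"

definition sym_weighing_order :: "nat \<Rightarrow> nat \<Rightarrow> bool" where
  "sym_weighing_order k n \<longleftrightarrow> (\<exists>f. sym_weighing_on {..<n} k f)"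

definition all_large_orders :: "nat \<Rightarrow> bool" where
  "all_large_orders k \<longleftrightarrow> (\<exists>N. \<forall>n\<ge>N. sym_weighing_order k n)"

lemma sym_weighing_onI:
  assumes "\<And>x y. x \<in> X \<Longrightarrow> y \<in> X \<Longrightarrow> f x y \<in> {0, 1, -1}"
    and "\<And>x y. x \<in> X \<Longrightarrow> y \<in> X \<Longrightarrow> f x y = f y x"
    and "\<And>x y. x \<in> X \<Longrightarrow> y \<in> X \<Longrightarrow> (\<Sum>z\<in>X. f x z * f y z) = (if x = y then int k else 0)"
  shows "sym_weighing_on X k f"
  using assms unfolding sym_weighing_on_def by blast

lemma sym_weighing_onD:
  assumes "sym_weighing_on X k f" "x \<in> X" "y \<in> X"
  shows sym_weighing_on_entries: "f x y \<in> {0, 1, -1}"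
    and sym_weighing_on_sym: "f x y = f y x"
    and sym_weighing_on_sum: "(\<Sum>z\<in>X. f x z * f y z) = (if x = y then int k else 0)"
  using assms unfolding sym_weighing_on_def by blast+

text \<open>Relabelling rows and columns by one and the same bijection preserves symmetry, so each
  construction may use its natural index set.\<close>

lemma sym_weighing_order_card:
  assumes "finite X" "sym_weighing_on X k f"
  shows "sym_weighing_order k (card X)"
proof -
  obtain h where h: "bij_betw h {..<card X} X"
    using ex_bij_betw_nat_finite[OF assms(1)] by (auto simp: atLeast0LessThan)
  have inX: "h i \<in> X" if "i < card X" for i
    using h that by (auto simp: bij_betw_def)
  have inj: "h i = h j \<longleftrightarrow> i = j" if "i < card X" "j < card X" for i j
    using h that by (auto simp: bij_betw_def inj_on_def)
  have sum: "(\<Sum>z<card X. f x (h z) * f y (h z)) = (\<Sum>z\<in>X. f x z * f y z)" for x y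
    by (rule sum.reindex_bij_betw[OF h])
  have "sym_weighing_on {..<card X} k (\<lambda>i j. f (h i) (h j))"
    by (rule sym_weighing_onI, goal_cases)
      (use sym_weighing_onD[OF assms(2) inX inX] in \<open>auto simp: sum inj\<close>)
  then show ?thesis
    unfolding sym_weighing_order_def by blast
qed

lemma sym_weighing_order_weighing_matrix:
  assumes "sym_weighing_order k n"
  shows "\<exists>W. weighing_matrix n k W \<and> symmetric_mat W"
proof -
  obtain f where f: "sym_weighing_on {..<n} k f"
    using assms unfolding sym_weighing_order_def by blast
  define W where "W = mat n n (\<lambda>(i, j). f i j)"
  have carr: "W \<in> carrier_mat n n"
    by (simp add: W_def)
  have "elements_mat W \<subseteq> {0, 1, -1}"
    using sym_weighing_on_entries[OF f] by (fastforce simp: W_def elements_mat_def)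
  moreover have "W * transpose_mat W = int k \<cdot>\<^sub>m 1\<^sub>m n"
    using sym_weighing_on_sum[OF f] by (intro eq_matI)
      (auto simp: W_def scalar_prod_def atLeast0LessThan)
  moreover have "transpose_mat W = W"
    using sym_weighing_on_sym[OF f] by (intro eq_matI) (auto simp: W_def)
  ultimately show ?thesis
    using carr unfolding weighing_matrix_def symmetric_mat_def by blast
qed

text \<open>The empty matrix, which allows a zero coefficient when orders are combined.\<close>

lemma sym_weighing_order_0: "sym_weighing_order k 0"
  by (simp add: sym_weighing_order_def sym_weighing_on_def)

lemma sym_weighing_order_1_1: "sym_weighing_order 1 1"
  unfolding sym_weighing_order_def sym_weighing_on_def
  by (rule exI[of _ "\<lambda>_ _. 1"]) auto

lemma sym_weighing_order_add:
  assumes "sym_weighing_order k m" "sym_weighing_order k n"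
  shows "sym_weighing_order k (m + n)"
proof -
  obtain f g where f: "sym_weighing_on {..<m} k f" and g: "sym_weighing_on {..<n} k g"
    using assms unfolding sym_weighing_order_def by blast
  define h :: "nat + nat \<Rightarrow> nat + nat \<Rightarrow> int" where
    "h x y = (case (x, y) of (Inl a, Inl b) \<Rightarrow> f a b | (Inr a, Inr b) \<Rightarrow> g a b | _ \<Rightarrow> 0)" for x y
  have "sym_weighing_on ({..<m} <+> {..<n}) k h"
  proof (rule sym_weighing_onI)
    fix x y assume xy: "x \<in> {..<m} <+> {..<n}" "y \<in> {..<m} <+> {..<n}"
    show "h x y \<in> {0, 1, -1}"
      using xy sym_weighing_on_entries[OF f] sym_weighing_on_entries[OF g]
      by (cases x; cases y) (auto simp: h_def)
    show "h x y = h y x"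
      using xy sym_weighing_on_sym[OF f] sym_weighing_on_sym[OF g]
      by (cases x; cases y) (auto simp: h_def)
    show "(\<Sum>z\<in>{..<m} <+> {..<n}. h x z * h y z) = (if x = y then int k else 0)"
      using xy sym_weighing_on_sum[OF f] sym_weighing_on_sum[OF g]
      by (cases x; cases y) (auto simp: h_def sum.Plus)
  qed
  from sym_weighing_order_card[OF _ this] show ?thesis
    by (simp add: card_Plus)
qed

lemma sym_weighing_order_mult_left:
  assumes "sym_weighing_order k m"
  shows "sym_weighing_order k (a * m)"
  by (induction a) (auto simp: sym_weighing_order_0 intro: sym_weighing_order_add assms)

lemma sym_weighing_order_tensor:
  assumes "sym_weighing_order k m" "sym_weighing_order l n"
  shows "sym_weighing_order (k * l) (m * n)"
proof -
  obtain f g where f: "sym_weighing_on {..<m} k f" and g: "sym_weighing_on {..<n} l g"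
    using assms unfolding sym_weighing_order_def by blast
  define h where "h x y = f (fst x) (fst y) * g (snd x) (snd y)" for x y
  \<comment> \<open>In a Kronecker product the inner product of two rows factors into the inner
    products of the component rows.\<close>
  have sum: "(\<Sum>z\<in>{..<m}\<times>{..<n}. h x z * h y z) =
      (\<Sum>z<m. f (fst x) z * f (fst y) z) * (\<Sum>z<n. g (snd x) z * g (snd y) z)" for x y
    unfolding sum_product sum.cartesian_product
    by (rule sum.cong) (auto simp: h_def)
  have "sym_weighing_on ({..<m} \<times> {..<n}) (k * l) h"
  proof (rule sym_weighing_onI)
    fix x y assume "x \<in> {..<m} \<times> {..<n}" "y \<in> {..<m} \<times> {..<n}"
    then have xy: "fst x \<in> {..<m}" "fst y \<in> {..<m}" "snd x \<in> {..<n}" "snd y \<in> {..<n}"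
      by auto
    note F = sym_weighing_onD[OF f xy(1,2)] and G = sym_weighing_onD[OF g xy(3,4)]
    show "h x y \<in> {0, 1, -1}"
      using F(1) G(1) unfolding h_def by fastforce
    show "h x y = h y x"
      using F(2) G(2) unfolding h_def by simp
    show "(\<Sum>z\<in>{..<m}\<times>{..<n}. h x z * h y z) = (if x = y then int (k * l) else 0)"
      unfolding sum F(3) G(3) by (auto simp: prod_eq_iff)
  qed
  from sym_weighing_order_card[OF _ this] show ?thesis
    by simp
qed

section \<open>From two coprime orders to all large orders\<close>

lemma coprime_nat_combination:
  fixes a b n :: nat
  assumes "coprime a b" "b > 0" "n \<ge> a * b"
  shows "\<exists>x y. n = x * a + y * b"
proof -
  obtain c where c: "[a * c = 1] (mod b)"
    using assms(1) cong_solve_coprime_nat by auto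
  \<comment> \<open>Since \<open>c\<close> inverts \<open>a\<close> modulo \<open>b\<close>,
    \<open>x\<close> is the residue of the quotient of \<open>n\<close> by \<open>a\<close>, so
    \<open>x * a\<close> agrees with \<open>n\<close> modulo \<open>b\<close>.\<close>
  define x where "x = (c * n) mod b"
  have "[x * a = (c * n) * a] (mod b)"
    unfolding x_def by (intro cong_mult) auto
  also have "(c * n) * a = (a * c) * n"
    by simp
  also have "[(a * c) * n = 1 * n] (mod b)"
    using c by (intro cong_mult) auto
  finally have "[n = x * a] (mod b)"
    by (simp add: cong_sym)
  \<comment> \<open>The threshold \<open>a * b\<close> enters here: it makes the natural-number
    difference \<open>n - x * a\<close> a genuine one.\<close>
  moreover have "x * a \<le> n"
  proof -
    have "x \<le> b"
      using assms(2) by (simp add: x_def less_imp_le)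
    then have "x * a \<le> b * a"
      by (rule mult_le_mono1)
    also have "\<dots> \<le> n"
      using assms(3) by (simp add: mult.commute)
    finally show ?thesis .
  qed
  ultimately have "b dvd n - x * a"
    by (simp add: cong_altdef_nat)
  then obtain y where "n - x * a = b * y"
    by (elim dvdE)
  then have "n = x * a + y * b"
    using \<open>x * a \<le> n\<close> by (simp add: mult.commute)
  then show ?thesis
    by blast
qed

lemma all_large_orders_coprime:
  assumes "sym_weighing_order k a" "sym_weighing_order k b" "coprime a b" "b > 0"
  shows "all_large_orders k"
  unfolding all_large_orders_def
proof (intro exI allI impI)
  fix n assume "n \<ge> a * b"
  then obtain x y where "n = x * a + y * b"
    using coprime_nat_combination assms(3,4) by blast
  then show "sym_weighing_order k n"
    using assms(1,2) by (auto intro: sym_weighing_order_add sym_weighing_order_mult_left)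
qed

text \<open>Tensor products reach only products of orders, but two coprime products already
  suffice.\<close>

lemma all_large_orders_mult:
  assumes "all_large_orders k" "all_large_orders l"
  shows "all_large_orders (k * l)"
proof -
  obtain M N where M: "\<And>n. n \<ge> M \<Longrightarrow> sym_weighing_order k n"
    and N: "\<And>n. n \<ge> N \<Longrightarrow> sym_weighing_order l n"
    using assms unfolding all_large_orders_def by blast
  \<comment> \<open>\<open>a\<close> exceeds both thresholds, and so does \<open>b\<close>, which is
    at least \<open>a\<close>. As \<open>b\<close> is 1 modulo \<open>a\<close>, the squares of
    \<open>a\<close> and \<open>b\<close> are coprime.\<close>
  define a where "a = Suc (M + N)"
  define b where "b = a * a + 1"
  have "a \<le> b"
    unfolding b_def by (metis le_square le_add1 le_trans)
  have "sym_weighing_order (k * l) (a * a)"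
    by (intro sym_weighing_order_tensor M N) (auto simp: a_def)
  moreover have "sym_weighing_order (k * l) (b * b)"
    by (intro sym_weighing_order_tensor M N) (use \<open>a \<le> b\<close> in \<open>auto simp: a_def\<close>)
  moreover have "coprime a b"
    unfolding b_def by (metis coprime_1_right coprime_iff_gcd_eq_1 gcd_add_mult add.commute)
  then have "coprime (a * a) (b * b)"
    by simp
  moreover have "b * b > 0"
    by (simp add: b_def)
  ultimately show ?thesis
    by (rule all_large_orders_coprime)
qed

lemma all_large_orders_1: "all_large_orders 1"
  using all_large_orders_coprime[of 1 1 1] sym_weighing_order_1_1 by simp

section \<open>Weight 4\<close>

lemma sym_weighing_order_2_2: "sym_weighing_order 2 2"
  unfolding sym_weighing_order_def sym_weighing_on_def
  by (rule exI[of _ "\<lambda>x y. (-1) ^ (x * y)"]) (auto simp: lessThan_nat_numeral less_2_cases_iff)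

text \<open>The row has -1 at 0 and 1 at the nonzero squares 1, 2, 4 modulo 7, a (7,3,1) difference
  set. Each nonzero shift is once a difference of two squares, contributing 1, and once a difference
  involving 0, contributing -1, so distinct rows are orthogonal. Dependence on \<open>x + y\<close>
  alone gives symmetry.\<close>

lemma sym_weighing_order_4_7: "sym_weighing_order 4 7"
proof -
  define f :: "nat \<Rightarrow> nat \<Rightarrow> int" where
    "f x y = [-1, 1, 1, 0, 1, 0, 0] ! ((x + y) mod 7)" for x y
  \<comment> \<open>An explicit list makes the bounded quantifiers and sums executable.\<close>
  have set: "{..<7} = set [0::nat, 1, 2, 3, 4, 5, 6]"
    by (auto simp: lessThan_nat_numeral)
  have "sym_weighing_on {..<7} 4 f"
    unfolding sym_weighing_on_def f_def set by code_simp
  then show ?thesis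
    unfolding sym_weighing_order_def by blast
qed

lemma all_large_orders_4: "all_large_orders 4"
proof (rule all_large_orders_coprime)
  show "sym_weighing_order 4 4"
    using sym_weighing_order_tensor[OF sym_weighing_order_2_2 sym_weighing_order_2_2] by simp
  show "coprime 4 (7::nat)"
    by (simp add: coprime_iff_gcd_eq_1 gcd_nat.simps)
qed (use sym_weighing_order_4_7 in auto)

section \<open>Legendre symbol sums\<close>

lemma bij_betw_mod_affine:
  fixes p c a :: int
  assumes "p > 0" "coprime c p"
  shows "bij_betw (\<lambda>t. (c * t + a) mod p) {0..<p} {0..<p}"
proof -
  have "inj_on (\<lambda>t. (c * t + a) mod p) {0..<p}"
  proof (rule inj_onI)
    fix x y assume xy: "x \<in> {0..<p}" "y \<in> {0..<p}" "(c * x + a) mod p = (c * y + a) mod p"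
    then have "[c * x + a = c * y + a] (mod p)"
      by (simp add: cong_def)
    then have "[x = y] (mod p)"
      using assms(2) by (simp add: cong_add_rcancel cong_mult_lcancel)
    then show "x = y"
      using xy(1,2) by (simp add: cong_def)
  qed
  moreover have "(\<lambda>t. (c * t + a) mod p) ` {0..<p} \<subseteq> {0..<p}"
    using assms(1) by auto
  ultimately show ?thesis
    by (simp add: bij_betw_def endo_inj_surj)
qed

text \<open>An affine map with invertible slope permutes the residues, so it leaves the complete sum
  of a periodic function unchanged.\<close>

lemma sum_mod_affine:
  fixes p c a :: int and f :: "int \<Rightarrow> int"
  assumes "p > 0" "coprime c p" "\<And>x y. [x = y] (mod p) \<Longrightarrow> f x = f y"
  shows "(\<Sum>t\<in>{0..<p}. f (c * t + a)) = (\<Sum>t\<in>{0..<p}. f t)"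
proof -
  have "(\<Sum>t\<in>{0..<p}. f (c * t + a)) = (\<Sum>t\<in>{0..<p}. f ((c * t + a) mod p))"
    by (intro sum.cong refl assms(3)) (simp add: cong_def)
  also have "\<dots> = (\<Sum>t\<in>{0..<p}. f t)"
    by (rule sum.reindex_bij_betw[OF bij_betw_mod_affine]) fact+
  finally show ?thesis .
qed

lemma Legendre_cong:
  assumes "[a = b] (mod p)"
  shows "Legendre a p = Legendre b p"
proof -
  have "[a = 0] (mod p) \<longleftrightarrow> [b = 0] (mod p)"
    using assms by (auto intro: cong_trans cong_sym)
  moreover have "QuadRes p a \<longleftrightarrow> QuadRes p b"
    unfolding QuadRes_def using assms by (meson cong_trans cong_sym)
  ultimately show ?thesis
    by (simp add: Legendre_def)
qed

lemma Legendre_range: "Legendre a p \<in> {0, 1, -1}"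
  by (simp add: Legendre_def)

lemma Legendre_eq_0_iff: "Legendre a p = 0 \<longleftrightarrow> p dvd a"
  by (auto simp: Legendre_def cong_0_iff)

lemma Legendre_square: "Legendre a p * Legendre a p = (if p dvd a then 0 else 1)"
  using Legendre_range[of a p] Legendre_eq_0_iff[of a p] by auto

locale odd_prime_int =
  fixes p :: int
  assumes prime_p: "prime p" and p_gt_2: "p > 2"
begin

lemma not_p_dvd: "0 < a \<Longrightarrow> a < p \<Longrightarrow> \<not> p dvd a"
  by (rule zdvd_not_zless)

text \<open>Euler's criterion gives the identity modulo \<open>p\<close>. Both sides lie in {-1, 0,
  1}, so they differ by at most 2, which is less than \<open>p\<close>.\<close>

lemma Legendre_mult: "Legendre (a * b) p = Legendre a p * Legendre b p"
proof -
  have P: "prime (nat p)" "2 < nat p" "int (nat p) = p"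
    using prime_p p_gt_2 by simp_all
  define e where "e = (nat p - 1) div 2"
  have euler: "[Legendre x p = x ^ e] (mod p)" for x
    using euler_criterion[OF P(1,2), of x] unfolding P(3) e_def .
  have "[Legendre (a * b) p = (a * b) ^ e] (mod p)"
    by (rule euler)
  also have "(a * b) ^ e = a ^ e * b ^ e"
    by (rule power_mult_distrib)
  also have "[a ^ e * b ^ e = Legendre a p * Legendre b p] (mod p)"
    by (intro cong_mult cong_sym[OF euler])
  finally have "p dvd Legendre (a * b) p - Legendre a p * Legendre b p"
    by (simp add: cong_iff_dvd_diff)
  moreover have "\<bar>Legendre (a * b) p - Legendre a p * Legendre b p\<bar> < p"
    using Legendre_range[of "a * b" p] Legendre_range[of a p] Legendre_range[of b p] p_gt_2
    by auto
  ultimately show ?thesis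
    using dvd_imp_le_int[of "Legendre (a * b) p - Legendre a p * Legendre b p" p] p_gt_2
    by linarith
qed

text \<open>Otherwise squaring would be onto the finite set of residues, hence injective, although 1
  and \<open>p - 1\<close> have the same square.\<close>

lemma ex_nonresidue: "\<exists>g. Legendre g p = -1"
proof (rule ccontr)
  assume neg: "\<nexists>g. Legendre g p = -1"
  have "{0..<p} \<subseteq> (\<lambda>y. y\<^sup>2 mod p) ` {0..<p}"
  proof
    fix a assume a: "a \<in> {0..<p}"
    have "QuadRes p a"
    proof (cases "[a = 0] (mod p)")
      case True
      then have "[0\<^sup>2 = a] (mod p)"
        by (simp add: cong_sym)
      then show ?thesis
        unfolding QuadRes_def by blast
    qed (use neg in \<open>auto simp: Legendre_def split: if_splits\<close>)
    then obtain y where "[y\<^sup>2 = a] (mod p)"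
      unfolding QuadRes_def by blast
    then have "a = (y mod p)\<^sup>2 mod p"
      using a by (simp add: cong_def power_mod)
    then show "a \<in> (\<lambda>y. y\<^sup>2 mod p) ` {0..<p}"
      using p_gt_2 by auto
  qed
  then have "inj_on (\<lambda>y. y\<^sup>2 mod p) {0..<p}"
    by (rule finite_surj_inj[rotated]) simp
  moreover have "1\<^sup>2 mod p = (p - 1)\<^sup>2 mod p"
  proof -
    have "(p - 1)\<^sup>2 = 1\<^sup>2 + p * (p - 2)"
      by (simp add: power2_eq_square algebra_simps)
    then show ?thesis
      by (metis mod_mult_self2)
  qed
  ultimately have "1 = p - 1"
    using p_gt_2 by (elim inj_onD) auto
  then show False
    using p_gt_2 by simp
qed

lemma coprime_iff_not_dvd: "coprime c p \<longleftrightarrow> \<not> p dvd c"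
  using prime_p by (metis coprime_commute not_prime_unit prime_imp_coprime coprime_absorb_left)

text \<open>Multiplication by a nonresidue permutes the residues and negates every summand.\<close>

lemma sum_Legendre: "(\<Sum>t\<in>{0..<p}. Legendre t p) = 0"
proof -
  obtain g where g: "Legendre g p = -1"
    using ex_nonresidue by blast
  then have "coprime g p"
    using Legendre_eq_0_iff[of g p] by (simp add: coprime_iff_not_dvd)
  then have "(\<Sum>t\<in>{0..<p}. Legendre t p) = (\<Sum>t\<in>{0..<p}. Legendre (g * t + 0) p)"
    using p_gt_2 by (intro sum_mod_affine[where f = "\<lambda>x. Legendre x p", symmetric] Legendre_cong) simp_all
  also have "\<dots> = - (\<Sum>t\<in>{0..<p}. Legendre t p)"
    by (simp add: Legendre_mult g sum_negf)
  finally show ?thesis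
    by simp
qed

lemma sum_Legendre_square: "(\<Sum>t\<in>{0..<p}. Legendre t p * Legendre t p) = p - 1"
proof -
  have "(\<Sum>t\<in>{0..<p}. Legendre t p * Legendre t p) = (\<Sum>t\<in>{0..<p}. if t = 0 then 0 else 1)"
    by (intro sum.cong refl) (auto simp: Legendre_square dest: zdvd_imp_le)
  also have "\<dots> = (\<Sum>t\<in>{0..<p} - {0}. 1)"
    by (intro sum.mono_neutral_cong_right) auto
  also have "\<dots> = p - 1"
    using p_gt_2 by (simp add: card_Diff_subset)
  finally show ?thesis .
qed

end

section \<open>The matrix of a projective space over a prime field\<close>

text \<open>Not reduced modulo \<open>p\<close>: the Legendre symbol sees only the residue class,
  and direction vectors may have arbitrary integer entries.\<close>

definition dot :: "nat \<Rightarrow> (nat \<Rightarrow> int) \<Rightarrow> (nat \<Rightarrow> int) \<Rightarrow> int" where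
  "dot n u w = (\<Sum>i<n. u i * w i)"

text \<open>Models the space of \<open>n\<close>-tuples over the prime field by canonical residues;
  extensionality makes equality of functions equality of vectors.\<close>

definition vecs :: "nat \<Rightarrow> int \<Rightarrow> (nat \<Rightarrow> int) set" where
  "vecs n p = {..<n} \<rightarrow>\<^sub>E {0..<p}"

definition add_mod :: "nat \<Rightarrow> int \<Rightarrow> (nat \<Rightarrow> int) \<Rightarrow> int \<Rightarrow> (nat \<Rightarrow> int) \<Rightarrow> nat \<Rightarrow> int" where
  "add_mod n p w0 t w = (\<lambda>i\<in>{..<n}. (w i + t * w0 i) mod p)"

definition scale_mod :: "nat \<Rightarrow> int \<Rightarrow> int \<Rightarrow> (nat \<Rightarrow> int) \<Rightarrow> nat \<Rightarrow> int" where
  "scale_mod n p c w = (\<lambda>i\<in>{..<n}. (c * w i) mod p)"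

definition leading_one :: "nat \<Rightarrow> (nat \<Rightarrow> int) \<Rightarrow> nat \<Rightarrow> bool" where
  "leading_one n v i \<longleftrightarrow> i < n \<and> v i = 1 \<and> (\<forall>j<i. v j = 0)"

text \<open>Each projective point is represented by its vector with first nonzero entry 1.\<close>
definition proj_points :: "nat \<Rightarrow> int \<Rightarrow> (nat \<Rightarrow> int) set" where
  "proj_points n p = {v \<in> vecs n p. \<exists>i. leading_one n v i}"

lemma dot_commute: "dot n u w = dot n w u"
  by (simp add: dot_def mult.commute)

lemma finite_vecs: "finite (vecs n p)"
  unfolding vecs_def by (intro finite_PiE) auto

lemma finite_proj_points: "finite (proj_points n p)"
  unfolding proj_points_def using finite_vecs by simp

lemma vecs_range: "v \<in> vecs n p \<Longrightarrow> i < n \<Longrightarrow> 0 \<le> v i \<and> v i < p"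
  using PiE_mem[of v "{..<n}" "\<lambda>_. {0..<p}" i] by (simp add: vecs_def)

lemma restrict_mod_vecs: "p > 0 \<Longrightarrow> (\<lambda>i\<in>{..<n}. f i mod p) \<in> vecs n p"
  unfolding vecs_def by (rule PiE_I) simp_all

lemma restrict_zero_vecs: "p > 0 \<Longrightarrow> (\<lambda>i\<in>{..<n}. 0) \<in> vecs n p"
  unfolding vecs_def by (rule PiE_I) simp_all

lemma vecs_eqI:
  assumes "v \<in> vecs n p" "w \<in> vecs n p" "\<And>i. i < n \<Longrightarrow> [v i = w i] (mod p)"
  shows "v = w"
proof (rule PiE_ext)
  show "v \<in> {..<n} \<rightarrow>\<^sub>E {0..<p}" "w \<in> {..<n} \<rightarrow>\<^sub>E {0..<p}"
    using assms(1,2) by (simp_all add: vecs_def)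
  show "v i = w i" if "i \<in> {..<n}" for i
    using assms(3)[of i] that vecs_range[OF assms(1), of i] vecs_range[OF assms(2), of i]
    by (simp add: cong_def)
qed

lemma card_vecs: "p \<ge> 0 \<Longrightarrow> int (card (vecs n p)) = p ^ n"
  by (simp add: vecs_def card_PiE)

lemma bij_betw_add_mod:
  assumes "p > 0"
  shows "bij_betw (add_mod n p w0 t) (vecs n p) (vecs n p)"
proof -
  have "inj_on (add_mod n p w0 t) (vecs n p)"
  proof (rule inj_onI)
    fix v w assume vw: "v \<in> vecs n p" "w \<in> vecs n p" "add_mod n p w0 t v = add_mod n p w0 t w"
    show "v = w"
    proof (rule vecs_eqI[OF vw(1,2)])
      fix i assume "i < n"
      then have "[v i + t * w0 i = w i + t * w0 i] (mod p)"
        using fun_cong[OF vw(3), of i] by (simp add: add_mod_def cong_def)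
      then show "[v i = w i] (mod p)"
        by (simp add: cong_add_rcancel)
    qed
  qed
  moreover have "add_mod n p w0 t ` vecs n p \<subseteq> vecs n p"
    using restrict_mod_vecs[OF assms] by (simp add: add_mod_def image_subset_iff)
  ultimately show ?thesis
    by (simp add: bij_betw_def endo_inj_surj finite_vecs)
qed

text \<open>The right-hand side is arranged as an affine function of \<open>t\<close>, ready for
  \<open>sum_mod_affine\<close>.\<close>

lemma dot_add_mod: "[dot n u (add_mod n p w0 t w) = dot n u w0 * t + dot n u w] (mod p)"
proof -
  have "[dot n u (add_mod n p w0 t w) = (\<Sum>i<n. u i * (w i + t * w0 i))] (mod p)"
    unfolding dot_def
    by (intro cong_sum cong_mult cong_refl) (simp add: add_mod_def cong_def)
  also have "(\<Sum>i<n. u i * (w i + t * w0 i)) = dot n u w0 * t + dot n u w"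
    by (simp add: dot_def algebra_simps sum.distrib sum_distrib_left)
  finally show ?thesis .
qed

lemma dot_scale_mod: "[dot n u (scale_mod n p c w) = c * dot n u w] (mod p)"
proof -
  have "[dot n u (scale_mod n p c w) = (\<Sum>i<n. u i * (c * w i))] (mod p)"
    unfolding dot_def
    by (intro cong_sum cong_mult cong_refl) (simp add: scale_mod_def cong_def)
  also have "(\<Sum>i<n. u i * (c * w i)) = c * dot n u w"
    by (simp add: dot_def algebra_simps sum_distrib_left)
  finally show ?thesis .
qed

section \<open>Character sums over the whole vector space\<close>

context odd_prime_int
begin

text \<open>
  Averaging over all translates in a direction \<open>w0\<close> turns the sums over the whole space into
  complete character sums on a line. With \<open>w0\<close> orthogonal to \<open>u\<close> but not to \<open>v\<close> the first factor
  is constant on the line, which gives the orthogonality of rows.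
\<close>
lemma sum_Legendre_translate:
  "p * (\<Sum>w\<in>vecs n p. Legendre (dot n u w) p * Legendre (dot n v w) p) =
   (\<Sum>w\<in>vecs n p. \<Sum>t\<in>{0..<p}. Legendre (dot n u w0 * t + dot n u w) p *
      Legendre (dot n v w0 * t + dot n v w) p)"
proof -
  let ?F = "\<lambda>w. Legendre (dot n u w) p * Legendre (dot n v w) p"
  have "(\<Sum>w\<in>vecs n p. ?F w) = (\<Sum>w\<in>vecs n p. ?F (add_mod n p w0 t w))" for t
    using p_gt_2 by (intro sum.reindex_bij_betw[symmetric] bij_betw_add_mod) simp
  also have "\<dots> t = (\<Sum>w\<in>vecs n p. Legendre (dot n u w0 * t + dot n u w) p *
      Legendre (dot n v w0 * t + dot n v w) p)" for t
    by (intro sum.cong refl arg_cong2[of _ _ _ _ "(*)"] Legendre_cong dot_add_mod)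
  finally have shift: "(\<Sum>w\<in>vecs n p. ?F w) = (\<Sum>w\<in>vecs n p. Legendre (dot n u w0 * t + dot n u w) p *
      Legendre (dot n v w0 * t + dot n v w) p)" for t .
  have "p * (\<Sum>w\<in>vecs n p. ?F w) = (\<Sum>t\<in>{0..<p}. \<Sum>w\<in>vecs n p. ?F w)"
    using p_gt_2 by simp
  also have "\<dots> = (\<Sum>t\<in>{0..<p}. \<Sum>w\<in>vecs n p. Legendre (dot n u w0 * t + dot n u w) p *
      Legendre (dot n v w0 * t + dot n v w) p)"
    by (intro sum.cong refl shift)
  also have "\<dots> = (\<Sum>w\<in>vecs n p. \<Sum>t\<in>{0..<p}. Legendre (dot n u w0 * t + dot n u w) p *
      Legendre (dot n v w0 * t + dot n v w) p)"
    by (rule sum.swap)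
  finally show ?thesis .
qed

lemma sum_vecs_orthogonal:
  assumes "dot n u w0 = 0" "\<not> p dvd dot n v w0"
  shows "(\<Sum>w\<in>vecs n p. Legendre (dot n u w) p * Legendre (dot n v w) p) = 0"
proof -
  have "(\<Sum>t\<in>{0..<p}. Legendre (dot n v w0 * t + dot n v w) p) = 0" for w
  proof -
    have "(\<Sum>t\<in>{0..<p}. Legendre (dot n v w0 * t + dot n v w) p) = (\<Sum>t\<in>{0..<p}. Legendre t p)"
    proof (rule sum_mod_affine[where f = "\<lambda>x. Legendre x p"])
      show "coprime (dot n v w0) p"
        using assms(2) by (simp only: coprime_iff_not_dvd not_False_eq_True)
      show "p > 0"
        using p_gt_2 by linarith
    qed (rule Legendre_cong)
    then show ?thesis
      by (simp only: sum_Legendre)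
  qed
  then have "p * (\<Sum>w\<in>vecs n p. Legendre (dot n u w) p * Legendre (dot n v w) p) = 0"
    by (simp add: sum_Legendre_translate[of n u v w0] assms(1) flip: sum_distrib_left)
  then show ?thesis
    using p_gt_2 by simp
qed

text \<open>Along a direction not orthogonal to \<open>u\<close>, each of the \<open>p ^ n\<close>
  base vectors contributes a complete sum of squares \<open>p - 1\<close>. Keeping the factor
  \<open>p\<close> on the left avoids a division.\<close>

lemma sum_vecs_diagonal:
  assumes "\<not> p dvd dot n u w0"
  shows "p * (\<Sum>w\<in>vecs n p. Legendre (dot n u w) p * Legendre (dot n u w) p) = p ^ n * (p - 1)"
proof -
  have "(\<Sum>t\<in>{0..<p}. Legendre (dot n u w0 * t + dot n u w) p *
      Legendre (dot n u w0 * t + dot n u w) p) = p - 1" for w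
  proof -
    have "(\<Sum>t\<in>{0..<p}. Legendre (dot n u w0 * t + dot n u w) p *
        Legendre (dot n u w0 * t + dot n u w) p) = (\<Sum>t\<in>{0..<p}. Legendre t p * Legendre t p)"
    proof (rule sum_mod_affine[where f = "\<lambda>x. Legendre x p * Legendre x p"])
      show "coprime (dot n u w0) p"
        using assms by (simp only: coprime_iff_not_dvd not_False_eq_True)
      show "Legendre x p * Legendre x p = Legendre y p * Legendre y p" if "[x = y] (mod p)" for x y
        using Legendre_cong[OF that] by simp
      show "p > 0"
        using p_gt_2 by linarith
    qed
    then show ?thesis
      by (simp only: sum_Legendre_square)
  qed
  then show ?thesis
    using p_gt_2 by (simp add: sum_Legendre_translate[of n u u w0] card_vecs)
qed

section \<open>Test vectors for projective points\<close>

lemma proj_points_dot_nonzero: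
  assumes "u \<in> proj_points n p"
  shows "\<exists>w0. \<not> p dvd dot n u w0"
proof -
  obtain i where i: "i < n" "u i = 1"
    using assms by (auto simp: proj_points_def leading_one_def)
  have "dot n u (\<lambda>l. if l = i then 1 else 0) = u i"
    using i(1) by (simp add: dot_def if_distrib cong: if_cong)
  then show ?thesis
    using i not_p_dvd[of 1] p_gt_2 by (intro exI[of _ "\<lambda>l. if l = i then 1 else 0"]) simp
qed

text \<open>Distinct normalised vectors are not proportional, so some 2 by 2 minor on column
  \<open>i\<close> and another column \<open>l\<close> is nonzero modulo \<open>p\<close>. A vector
  supported on \<open>i\<close> and \<open>l\<close> annihilates \<open>u\<close> and evaluates to
  this minor on \<open>v\<close>.\<close>

lemma proj_points_separate:
  assumes "u \<in> proj_points n p" "v \<in> proj_points n p" "u \<noteq> v"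
  shows "\<exists>w0. dot n u w0 = 0 \<and> \<not> p dvd dot n v w0"
proof -
  obtain i j where i: "leading_one n u i" and j: "leading_one n v j"
    using assms by (auto simp: proj_points_def)
  have V: "u \<in> vecs n p" "v \<in> vecs n p"
    using assms by (auto simp: proj_points_def)
  have "\<exists>l<n. l \<noteq> i \<and> \<not> p dvd u i * v l - u l * v i"
  proof (cases "i = j")
    case True
    obtain l where l: "l < n" "\<not> [u l = v l] (mod p)"
      using vecs_eqI[OF V] assms(3) by blast
    then have "\<not> p dvd v l - u l"
      by (metis cong_iff_dvd_diff cong_sym)
    then show ?thesis
      using l i j True by (auto simp: leading_one_def)
  next
    case False
    \<comment> \<open>The smaller of \<open>i\<close> and \<open>j\<close> lies before the leading
      position of the other vector, where that vector vanishes.\<close>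
    then have "u j * v i = 0"
      using i j unfolding leading_one_def by (metis linorder_neqE_nat mult_eq_0_iff)
    then have "u i * v j - u j * v i = 1"
      using i j by (simp add: leading_one_def)
    moreover have "\<not> p dvd 1"
      by (rule not_p_dvd) (use p_gt_2 in simp_all)
    ultimately have "\<not> p dvd u i * v j - u j * v i"
      by metis
    then show ?thesis
      using j False unfolding leading_one_def by blast
  qed
  then obtain l where l: "l < n" "l \<noteq> i" "\<not> p dvd u i * v l - u l * v i"
    by blast
  define w0 where "w0 = (\<lambda>m. if m = i then - u l else if m = l then u i else 0)"
  have dot: "dot n x w0 = x l * u i - x i * u l" for x
  proof -
    have "dot n x w0 = (\<Sum>m\<in>{i, l}. x m * w0 m)"
      unfolding dot_def using l(1) i
      by (intro sum.mono_neutral_right) (auto simp: w0_def leading_one_def)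
    then show ?thesis
      using l(2) by (simp add: w0_def)
  qed
  show ?thesis
    using l(3) by (intro exI[of _ w0]) (simp add: dot mult.commute)
qed

section \<open>Passing from nonzero vectors to projective points\<close>

lemma bij_betw_scale_mod:
  "bij_betw (\<lambda>(c, r). scale_mod n p c r) ({1..<p} \<times> proj_points n p)
     (vecs n p - {\<lambda>i\<in>{..<n}. 0})"
  unfolding bij_betw_def
proof
  \<comment> \<open>The first nonzero entry of a multiple of \<open>r\<close> reveals both the
    leading position and the scalar.\<close>
  have lead: "scale_mod n p c r i = c \<and> (\<forall>j<i. scale_mod n p c r j = 0)"
    if "leading_one n r i" "c \<in> {1..<p}" for c r i
    using that by (auto simp: scale_mod_def leading_one_def)
  show "inj_on (\<lambda>(c, r). scale_mod n p c r) ({1..<p} \<times> proj_points n p)"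
  proof (rule inj_onI, clarify)
    fix c r d s
    assume c: "c \<in> {1..<p}" and d: "d \<in> {1..<p}"
      and r: "r \<in> proj_points n p" and s: "s \<in> proj_points n p"
      and eq: "scale_mod n p c r = scale_mod n p d s"
    obtain i j where i: "leading_one n r i" and j: "leading_one n s j"
      using r s by (auto simp: proj_points_def)
    \<comment> \<open>At the smaller of two different positions the common vector would be both zero
      and a nonzero scalar.\<close>
    have "i = j"
      using lead[OF i c] lead[OF j d] eq c d by (metis atLeastLessThan_iff linorder_neqE_nat not_one_le_zero)
    then have "c = d"
      using lead[OF i c] lead[OF j d] eq by simp
    moreover have "r = s"
    proof (rule vecs_eqI)
      show "r \<in> vecs n p" "s \<in> vecs n p"
        using r s by (auto simp: proj_points_def)
      fix m assume "m < n"
      then have "[c * r m = c * s m] (mod p)"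
        using fun_cong[OF eq, of m] \<open>c = d\<close> by (simp add: scale_mod_def cong_def)
      moreover have "coprime c p"
        using c by (auto simp: coprime_iff_not_dvd not_p_dvd)
      ultimately show "[r m = s m] (mod p)"
        by (simp add: cong_mult_lcancel)
    qed
    ultimately show "c = d \<and> r = s"
      by simp
  qed
  show "(\<lambda>(c, r). scale_mod n p c r) ` ({1..<p} \<times> proj_points n p) = vecs n p - {\<lambda>i\<in>{..<n}. 0}"
  proof (intro subset_antisym subsetI)
    fix v assume "v \<in> (\<lambda>(c, r). scale_mod n p c r) ` ({1..<p} \<times> proj_points n p)"
    then obtain c r where c: "c \<in> {1..<p}" and r: "r \<in> proj_points n p" and v: "v = scale_mod n p c r"
      by auto
    obtain i where i: "leading_one n r i"
      using r by (auto simp: proj_points_def)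
    have "v i \<noteq> 0"
      using lead[OF i c] c v by simp
    moreover have "v \<in> vecs n p"
      using p_gt_2 unfolding v scale_mod_def by (intro restrict_mod_vecs) simp
    ultimately show "v \<in> vecs n p - {\<lambda>i\<in>{..<n}. 0}"
      using i by (auto simp: leading_one_def)
  next
    fix v assume v: "v \<in> vecs n p - {\<lambda>i\<in>{..<n}. 0}"
    have "\<exists>i. i < n \<and> v i \<noteq> 0"
    proof (rule ccontr)
      assume "\<not> ?thesis"
      then have "v = (\<lambda>i\<in>{..<n}. 0)"
        using v restrict_zero_vecs[of p n] p_gt_2 by (intro vecs_eqI[of _ n p]) simp_all
      then show False
        using v by simp
    qed
    then obtain i where i: "i < n" "v i \<noteq> 0" and least: "\<And>j. j < i \<Longrightarrow> \<not> (j < n \<and> v j \<noteq> 0)"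
      using exists_least_iff[of "\<lambda>i. i < n \<and> v i \<noteq> 0"] by blast
    have range: "v i \<in> {1..<p}"
      using vecs_range[of v n p i] v i by auto
    then have "coprime (v i) p"
      by (auto simp: coprime_iff_not_dvd not_p_dvd)
    \<comment> \<open>Dividing by the first nonzero entry normalises \<open>v\<close>, and that
      entry is the scalar sought.\<close>
    then obtain e where e: "[v i * e = 1] (mod p)"
      using cong_solve_coprime_int by blast
    define r where "r = scale_mod n p e v"
    have rV: "r \<in> vecs n p"
      using p_gt_2 unfolding r_def scale_mod_def by (intro restrict_mod_vecs) simp
    have "leading_one n r i"
      using i least e p_gt_2
      by (auto simp: leading_one_def r_def scale_mod_def cong_def mult.commute)
    then have "r \<in> proj_points n p"
      using rV by (auto simp: proj_points_def)
    moreover have "v = scale_mod n p (v i) r"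
    proof (rule vecs_eqI)
      show "scale_mod n p (v i) r \<in> vecs n p"
        using p_gt_2 unfolding scale_mod_def by (intro restrict_mod_vecs) simp
      fix m assume "m < n"
      then have "[scale_mod n p (v i) r m = v i * (e * v m)] (mod p)"
        by (simp add: scale_mod_def r_def cong_def mod_mult_right_eq)
      also have "v i * (e * v m) = (v i * e) * v m"
        by simp
      also have "[(v i * e) * v m = 1 * v m] (mod p)"
        by (intro cong_mult e cong_refl)
      finally show "[v m = scale_mod n p (v i) r m] (mod p)"
        by (simp add: cong_sym)
    qed (use v in simp)
    ultimately show "v \<in> (\<lambda>(c, r). scale_mod n p c r) ` ({1..<p} \<times> proj_points n p)"
      using range by (intro image_eqI[of _ _ "(v i, r)"]) auto
  qed
qed

lemma card_proj_points: "(p - 1) * int (card (proj_points n p)) = p ^ n - 1"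
proof -
  have "(\<lambda>i\<in>{..<n}. 0) \<in> vecs n p"
    using p_gt_2 by (intro restrict_zero_vecs) simp
  then have "int (card (vecs n p - {\<lambda>i\<in>{..<n}. 0})) = p ^ n - 1"
    using card_vecs[of p n] p_gt_2 card.remove[OF finite_vecs, of "\<lambda>i\<in>{..<n}. 0" n p] by linarith
  moreover have "int (card (vecs n p - {\<lambda>i\<in>{..<n}. 0})) = (p - 1) * int (card (proj_points n p))"
    using p_gt_2 unfolding bij_betw_same_card[OF bij_betw_scale_mod, symmetric]
    by (simp add: card_cartesian_product)
  ultimately show ?thesis
    by linarith
qed

text \<open>Scaling \<open>w\<close> by \<open>c\<close> multiplies both factors by the Legendre
  symbol of \<open>c\<close>, whose square is 1. The summand is thus constant on the
  \<open>p - 1\<close> nonzero multiples of a point.\<close>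

lemma sum_proj_points:
  "(p - 1) * (\<Sum>w\<in>proj_points n p. Legendre (dot n u w) p * Legendre (dot n v w) p) =
   (\<Sum>w\<in>vecs n p. Legendre (dot n u w) p * Legendre (dot n v w) p)"
proof -
  let ?F = "\<lambda>w. Legendre (dot n u w) p * Legendre (dot n v w) p"
  have scale: "?F (scale_mod n p c r) = ?F r" if "c \<in> {1..<p}" for c r
  proof -
    have "Legendre (dot n x (scale_mod n p c r)) p = Legendre c p * Legendre (dot n x r) p" for x
      using Legendre_cong[OF dot_scale_mod] by (simp add: Legendre_mult)
    moreover have "Legendre c p * Legendre c p = 1"
      using that by (auto simp: Legendre_square not_p_dvd)
    ultimately show ?thesis
      by (simp add: algebra_simps)
  qed
  \<comment> \<open>The zero vector contributes nothing, as the Legendre symbol of 0 is 0.\<close>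
  have "(\<Sum>w\<in>vecs n p. ?F w) = (\<Sum>w\<in>vecs n p - {\<lambda>i\<in>{..<n}. 0}. ?F w)"
    by (rule sum.mono_neutral_right) (auto simp: finite_vecs dot_def Legendre_eq_0_iff)
  also have "\<dots> = (\<Sum>(c, r)\<in>{1..<p} \<times> proj_points n p. ?F (scale_mod n p c r))"
    by (subst sum.reindex_bij_betw[OF bij_betw_scale_mod, symmetric]) (simp add: case_prod_unfold)
  also have "\<dots> = (\<Sum>(c, r)\<in>{1..<p} \<times> proj_points n p. ?F r)"
    by (intro sum.cong refl) (use scale in auto)
  also have "\<dots> = (p - 1) * (\<Sum>r\<in>proj_points n p. ?F r)"
    using p_gt_2 by (simp flip: sum.cartesian_product)
  finally show ?thesis
    by simp
qed

lemma sym_weighing_on_proj_points: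
  assumes "n > 0"
  shows "sym_weighing_on (proj_points n p) (nat p ^ (n - 1)) (\<lambda>u v. Legendre (dot n u v) p)"
proof (rule sym_weighing_onI)
  fix u v assume uv: "u \<in> proj_points n p" "v \<in> proj_points n p"
  show "Legendre (dot n u v) p \<in> {0, 1, -1}"
    by (rule Legendre_range)
  show "Legendre (dot n u v) p = Legendre (dot n v u) p"
    by (simp only: dot_commute)
  show "(\<Sum>w\<in>proj_points n p. Legendre (dot n u w) p * Legendre (dot n v w) p) =
      (if u = v then int (nat p ^ (n - 1)) else 0)"
  proof (cases "u = v")
    case False
    then show ?thesis
      using proj_points_separate[OF uv] sum_vecs_orthogonal sum_proj_points[of n u v] p_gt_2
      by auto
  next
    case True
    have "p * ((p - 1) * (\<Sum>w\<in>proj_points n p. Legendre (dot n u w) p * Legendre (dot n u w) p)) =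
        p ^ n * (p - 1)"
      using proj_points_dot_nonzero[OF uv(1)] sum_vecs_diagonal unfolding sum_proj_points by blast
    \<comment> \<open>Here \<open>n > 0\<close> enters: it allows \<open>p * (p - 1)\<close> to be
      cancelled and gives \<open>n - 1\<close> its usual meaning.\<close>
    also have "p ^ n = p * p ^ (n - 1)"
      using assms by (simp add: power_eq_if)
    finally show ?thesis
      using p_gt_2 True by simp
  qed
qed

lemma all_large_orders_square: "all_large_orders (nat p ^ 2)"
proof (rule all_large_orders_coprime)
  let ?q = "nat p"
  have ord: "sym_weighing_order (?q ^ (n - 1)) (card (proj_points n p))" if "n > 0" for n
    by (rule sym_weighing_order_card[OF finite_proj_points sym_weighing_on_proj_points[OF that]])
  have card2: "card (proj_points 2 p) = ?q + 1"
  proof -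
    have "(p - 1) * int (card (proj_points 2 p)) = (p - 1) * (p + 1)"
      unfolding card_proj_points by (simp add: power2_eq_square algebra_simps)
    then show ?thesis
      using p_gt_2 by auto
  qed
  have card3: "card (proj_points 3 p) = ?q * (?q + 1) + 1"
  proof -
    have "(p - 1) * int (card (proj_points 3 p)) = (p - 1) * (p * (p + 1) + 1)"
      unfolding card_proj_points by (simp add: power3_eq_cube algebra_simps)
    then have "int (card (proj_points 3 p)) = p * (p + 1) + 1"
      using p_gt_2 by simp
    also have "\<dots> = int (?q * (?q + 1) + 1)"
      using p_gt_2 by (simp add: distrib_left)
    finally show ?thesis
      by (simp only: of_nat_eq_iff)
  qed
  show "sym_weighing_order (?q ^ 2) ((?q + 1) * (?q + 1))"
    using sym_weighing_order_tensor[OF ord[of 2] ord[of 2]] card2 by (simp add: power2_eq_square)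
  show "sym_weighing_order (?q ^ 2) (?q * (?q + 1) + 1)"
    using ord[of 3] card3 by simp
  \<comment> \<open>The second number exceeds a multiple of the first by 1.\<close>
  have "coprime (?q + 1) (?q * (?q + 1) + 1)"
    by (meson coprime_add_one_right coprime_divisors dvd_triv_right dvd_refl)
  then show "coprime ((?q + 1) * (?q + 1)) (?q * (?q + 1) + 1)"
    by (simp only: coprime_mult_left_iff)
qed simp

end

section \<open>Assembly over the prime factors\<close>

lemma all_large_orders_prime_square:
  assumes "prime p"
  shows "all_large_orders (p ^ 2)"
proof (cases "p = 2")
  case True
  then show ?thesis
    using all_large_orders_4 by simp
next
  case False
  then have "odd_prime_int (int p)"
    using assms prime_ge_2_nat[OF assms] by unfold_locales auto
  from odd_prime_int.all_large_orders_square[OF this] show ?thesis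
    by simp
qed

text \<open>Squaring is multiplicative, so induction on the prime factorisation splits off one prime
  square at a time, starting from weight 1.\<close>

lemma all_large_orders_power2: "m > 0 \<Longrightarrow> all_large_orders (m ^ 2)"
proof (induction m rule: prime_divisors_induct)
  case (factor p x)
  then show ?case
    using all_large_orders_mult[OF all_large_orders_prime_square] by (simp add: power_mult_distrib)
qed (use all_large_orders_1 in auto)

theorem theorem3p11:
  fixes k :: nat
  assumes "k > 0" and "is_square k"
  shows "\<exists>N::nat. \<forall>n\<ge>N. \<exists>W. weighing_matrix n k W \<and> symmetric_mat W"
proof -
  obtain m where "k = m ^ 2"
    using assms(2) by (elim is_nth_powerE)
  then have "all_large_orders k"
    using all_large_orders_power2[of m] assms(1) by simp
  then show ?thesis
    unfolding all_large_orders_def using sym_weighing_order_weighing_matrix by blast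
qed

end
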